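(* Let $k$ be a variable part of the input, and consider $k$-matroids $(V,\mathcal{H})$, with $n=|V|$ and $1\le k<n$, presented implicitly by an independence oracle. Even if the matroid is paving, exponentially many oracle queries are needed in general to decide whether it is separable. (That is, deciding separability requires exponential time for paving matroids presented by independence oracles.)
   Context: A $k$-hypergraph is a pair $(V,\mathcal{H})$ with $V$ a finite set and $\mathcal{H}$ a set of $k$-element subsets of $V$. It is separable if there is a labeling $x:V\to\mathbb{R}$ such that, with $x(E):=\sum_{v\in E}x(v)$, $\mathcal{H}=\{E\subseteq V:|E|=k,\ x(E)\ge 0\}$. A $k$-matroid is a $k$-hypergraph $(V,\mathcal{H})$ with $\mathcal{H}\ne\emptyset$ such that for every $E_1,E_2\in\mathcal{H}$ and $v_1\in E_1\setminus E_2$ there is $v_2\in E_2\setminus E_1$ with $(E_1\setminus\{v_1\})\cup\{v_2\}\in\mathcal{H}$ (that is, $\mathcal{H}$ is the set of bases of a rank $k$ matroid on $V$). A set $I\subseteq V$ is independent if $I\subseteq E$ for some $E\in\mathcal{H}$. The matroid is paving if every $(k-1)$-subset of $V$ is independent. An independence oracle for $(V,\mathcal{H})$, queried on any subset $I\subseteq V$, replies YES if $I$ is independent and NO if it is not. The number of edges of $\mathcal{H}$ may be exponential in $k$ and $n$. *)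

theory Defs
  imports Complex_Main
begin

definition k_hypergraph :: "'v set \<Rightarrow> nat \<Rightarrow> 'v set set \<Rightarrow> bool" where
  "k_hypergraph V k H \<longleftrightarrow> finite V \<and> H \<subseteq> {E. E \<subseteq> V \<and> card E = k}"

definition separable_hypergraph :: "'v set \<Rightarrow> nat \<Rightarrow> 'v set set \<Rightarrow> bool" where
  "separable_hypergraph V k H \<longleftrightarrow>
     (\<exists>x :: 'v \<Rightarrow> real. H = {E. E \<subseteq> V \<and> card E = k \<and> (\<Sum>v\<in>E. x v) \<ge> 0})"

definition k_matroid :: "'v set \<Rightarrow> nat \<Rightarrow> 'v set set \<Rightarrow> bool" where
  "k_matroid V k H \<longleftrightarrow>
     k_hypergraph V k H \<and> H \<noteq> {} \<and>
     (\<forall>E1\<in>H. \<forall>E2\<in>H. \<forall>v1\<in>E1 - E2. \<exists>v2\<in>E2 - E1. (E1 - {v1}) \<union> {v2} \<in> H)"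

definition indep_in :: "'v set set \<Rightarrow> 'v set \<Rightarrow> bool" where
  "indep_in H I \<longleftrightarrow> (\<exists>E\<in>H. I \<subseteq> E)"

definition paving :: "'v set \<Rightarrow> nat \<Rightarrow> 'v set set \<Rightarrow> bool" where
  "paving V k H \<longleftrightarrow> (\<forall>I. I \<subseteq> V \<and> card I = k - 1 \<longrightarrow> indep_in H I)"

text \<open>
  Deterministic adaptive oracle computations, as possibly infinite interaction trees: a
  computation returns an answer, performs an internal step, or queries the oracle on a set and
  continues depending on the reply. Infinite branches are computations that do not halt; they
  are allowed, so an algorithm may behave arbitrarily on oracles outside the promised class.
\<close>

codatatype 'v program =
    Return bool
  | Step "'v program"
  | Query "'v set" "bool \<Rightarrow> 'v program"

text \<open>
  \<open>halts V orc p b q t\<close>: with oracle \<open>orc\<close> on the subsets of \<open>V\<close>, the computation \<open>p\<close> halts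
  with answer \<open>b\<close> after exactly \<open>q\<close> queries and \<open>t\<close> steps in total, each query counting as one
  step.
\<close>

inductive halts ::
  "'v set \<Rightarrow> ('v set \<Rightarrow> bool) \<Rightarrow> 'v program \<Rightarrow> bool \<Rightarrow> nat \<Rightarrow> nat \<Rightarrow> bool"
  for V :: "'v set" and orc :: "'v set \<Rightarrow> bool" where
  halts_Return: "halts V orc (Return b) b 0 0"
| halts_Step: "halts V orc p b q t \<Longrightarrow> halts V orc (Step p) b q (Suc t)"
| halts_Query: "I \<subseteq> V \<Longrightarrow> halts V orc (f (orc I)) b q t \<Longrightarrow>
    halts V orc (Query I f) b (Suc q) (Suc t)"

text \<open>
  An algorithm receives \<open>V\<close> and \<open>k\<close> explicitly and accesses \<open>H\<close> only through its independence
  oracle. Correctness is required on paving matroids only.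
\<close>

definition decides_separability_of_paving_matroids ::
  "('v set \<Rightarrow> nat \<Rightarrow> 'v program) \<Rightarrow> bool" where
  "decides_separability_of_paving_matroids A \<longleftrightarrow>
     (\<forall>V k H. 1 \<le> k \<and> k < card V \<and> k_matroid V k H \<and> paving V k H \<longrightarrow>
        (\<exists>q t. halts V (indep_in H) (A V k) (separable_hypergraph V k H) q t))"

end

theory Submission
  imports Defs
begin

text \<open>
  The proof is an adversary argument. Fix a \<open>k\<close>-subset \<open>E0\<close> of \<open>V\<close> and run the algorithm on the
  matroid \<open>M\<close> whose bases are all \<open>k\<close>-subsets of \<open>V\<close> except \<open>E0\<close>. Giving the elements of \<open>E0\<close> the
  label \<open>-1\<close> and all others the label \<open>k\<close> makes \<open>E0\<close> the only negative \<open>k\<close>-set, so \<open>M\<close> is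
  separable (\<open>separable_remove_one\<close>). Now let \<open>E\<close> be a \<open>k\<close>-set with \<open>\<bar>E \<inter> E0\<bar> \<le> k - 2\<close> and remove
  \<open>E\<close> from the bases as well. Because the two missing sets are far apart, the result is again a
  paving matroid (\<open>k_matroid_all_but\<close>, \<open>paving_all_but\<close>), and it is not separable: exchanging one
  element of \<open>E\<close> for one of \<open>E0\<close> turns the two non-bases into two bases with the same total label
  (\<open>not_separable_remove_two\<close>).

  The two independence oracles disagree on the single set \<open>E\<close> (\<open>indep_in_remove_two\<close>). A computation
  sees only the replies to its queries (\<open>halts_queries\<close>), so a correct algorithm run on \<open>M\<close> has to
  query every such \<open>E\<close>. For \<open>k = \<lfloor>n/2\<rfloor>\<close> there are at least \<open>2 ^ (k - 2)\<close> of them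
  (\<open>many_far_sets\<close>).
\<close>

section \<open>Oracle computations\<close>

lemma halts_deterministic:
  assumes "halts V orc p b q t" "halts V orc p b' q' t'"
  shows "b = b'"
  using assms
proof (induction arbitrary: b' q' t' rule: halts.induct)
  case (halts_Return b)
  then show ?case by (cases rule: halts.cases) auto
next
  case (halts_Step p b q t)
  from halts_Step.prems show ?case
    by (cases rule: halts.cases) (use halts_Step.IH in auto)
next
  case (halts_Query I f b q t)
  from halts_Query.prems show ?case
    by (cases rule: halts.cases) (use halts_Query.IH in auto)
qed

lemma halts_queries_le_steps: "halts V orc p b q t \<Longrightarrow> q \<le> t"
  by (induction rule: halts.induct) auto

text \<open>
  The set \<open>Q\<close> consists of the queries along the branch that is taken; an oracle with the same
  replies on \<open>Q\<close> leads down the same branch.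
\<close>

lemma halts_queries:
  assumes "halts V orc p b q t"
  obtains Q where "finite Q" "card Q \<le> q"
    "\<And>orc'. \<forall>I\<in>Q. orc' I = orc I \<Longrightarrow> halts V orc' p b q t"
proof -
  from assms have "\<exists>Q. finite Q \<and> card Q \<le> q \<and>
    (\<forall>orc'. (\<forall>I\<in>Q. orc' I = orc I) \<longrightarrow> halts V orc' p b q t)"
  proof (induction rule: halts.induct)
    case (halts_Return b)
    show ?case by (rule exI[of _ "{}"]) (auto intro: halts.halts_Return)
  next
    case (halts_Step p b q t)
    then show ?case by (blast intro: halts.halts_Step)
  next
    case (halts_Query I f b q t)
    then obtain Q where Q: "finite Q" "card Q \<le> q"
      "\<forall>orc'. (\<forall>I\<in>Q. orc' I = orc I) \<longrightarrow> halts V orc' (f (orc I)) b q t"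
      by blast
    have "halts V orc' (Query I f) b (Suc q) (Suc t)"
      if "\<forall>J\<in>insert I Q. orc' J = orc J" for orc'
      using that Q(3) \<open>I \<subseteq> V\<close> by (intro halts.halts_Query) auto
    moreover have "card (insert I Q) \<le> Suc q"
      using Q(1,2) by (simp add: card_insert_if)
    ultimately show ?case using Q(1) by (intro exI[of _ "insert I Q"]) auto
  qed
  then show thesis using that by blast
qed

section \<open>Uniform matroids with some bases removed\<close>

definition all_but :: "'v set \<Rightarrow> nat \<Rightarrow> 'v set set \<Rightarrow> 'v set set" where
  "all_but V k D = {E. E \<subseteq> V \<and> card E = k} - D"

definition far_apart :: "nat \<Rightarrow> 'v set set \<Rightarrow> bool" where
  "far_apart k D \<longleftrightarrow> (\<forall>E\<in>D. \<forall>F\<in>D. E \<noteq> F \<longrightarrow> Suc (card (E \<inter> F)) < k)"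

lemma obtain_two_elements:
  assumes "2 \<le> card A"
  obtains a b where "a \<in> A" "b \<in> A" "a \<noteq> b"
proof -
  obtain T where "T \<subseteq> A" "card T = 2" using assms by (meson obtain_subset_with_card_n)
  then show thesis using that by (auto simp: card_2_iff)
qed

text \<open>
  Two different one-element extensions of a \<open>(k - 1)\<close>-set meet in that set, hence they are too close
  to be both removed.
\<close>

lemma far_apart_extensions:
  assumes "far_apart k D" "Suc (card I) = k" "u \<noteq> w" "u \<notin> I" "w \<notin> I"
  shows "insert u I \<notin> D \<or> insert w I \<notin> D"
proof -
  have "insert u I \<inter> insert w I = I" "insert u I \<noteq> insert w I" using assms(3-5) by auto
  then show ?thesis using assms(1,2) by (metis far_apart_def less_irrefl)
qed

lemma paving_all_but:
  assumes "finite V" "1 \<le> k" "k < card V" "far_apart k D"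
  shows "paving V k (all_but V k D)"
  unfolding paving_def
proof (intro allI impI, elim conjE)
  fix I assume I: "I \<subseteq> V" "card I = k - 1"
  have fI: "finite I" using I assms(1) finite_subset by blast
  have "card (V - I) \<ge> 2" using I assms(1-3) fI by (simp add: card_Diff_subset)
  then obtain u w where uw: "u \<in> V - I" "w \<in> V - I" "u \<noteq> w" by (rule obtain_two_elements)
  have "insert u I \<notin> D \<or> insert w I \<notin> D"
    using far_apart_extensions[OF assms(4)] I assms(2) uw by auto
  moreover have "insert u I \<subseteq> V" "card (insert u I) = k" "insert w I \<subseteq> V" "card (insert w I) = k"
    using uw I fI assms(2) by auto
  ultimately have "insert u I \<in> all_but V k D \<or> insert w I \<in> all_but V k D"
    by (simp add: all_but_def)
  then show "indep_in (all_but V k D) I" unfolding indep_in_def by blast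
qed

text \<open>
  For the exchange property: if \<open>E2 - E1\<close> has one element, the exchange yields \<open>E2\<close> itself;
  otherwise there are two candidates and at most one of them has been removed.
\<close>

lemma k_matroid_all_but:
  assumes "finite V" "1 \<le> k" "k < card V" "far_apart k D"
  shows "k_matroid V k (all_but V k D)"
proof -
  have "k - 1 \<le> card V" using assms(3) by simp
  then obtain I where "I \<subseteq> V" "card I = k - 1"
    by (meson obtain_subset_with_card_n)
  then have ne: "all_but V k D \<noteq> {}"
    using paving_all_but[OF assms] unfolding paving_def indep_in_def by blast
  have exch: "\<exists>v2\<in>E2 - E1. (E1 - {v1}) \<union> {v2} \<in> all_but V k D"
    if E: "E1 \<in> all_but V k D" "E2 \<in> all_but V k D" and v1: "v1 \<in> E1 - E2" for E1 E2 v1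
  proof -
    let ?I = "E1 - {v1}"
    have EV: "E1 \<subseteq> V" "E2 \<subseteq> V" "card E1 = k" "card E2 = k"
      using E by (auto simp: all_but_def)
    have fin: "finite E1" "finite E2" using EV assms(1) finite_subset by blast+
    have cI: "Suc (card ?I) = k"
      using v1 fin EV(3) assms(2) by (simp add: card_Diff_singleton)
    have cand: "insert v2 ?I \<subseteq> V \<and> card (insert v2 ?I) = k" if "v2 \<in> E2 - E1" for v2
      using that EV fin cI by auto
    have "card (E2 - E1) = card (E1 - E2)"
      using fin EV by (metis card_Diff_subset_Int finite_Int inf_commute)
    then have pos: "card (E2 - E1) \<noteq> 0" using v1 fin by auto
    show ?thesis
    proof (cases "card (E2 - E1) = 1")
      case True
      then have "card (E1 - E2) = 1" using \<open>card (E2 - E1) = card (E1 - E2)\<close> by simp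
      then have "E1 - E2 = {v1}" using v1 by (metis card_1_singletonE singletonD)
      moreover obtain v2 where "E2 - E1 = {v2}" using True card_1_singletonE by blast
      ultimately have "?I \<union> {v2} = E2" by blast
      then show ?thesis using \<open>E2 - E1 = {v2}\<close> E(2) by (intro bexI[of _ v2]) simp_all
    next
      case False
      then have "card (E2 - E1) \<ge> 2" using pos by linarith
      then obtain u w where uw: "u \<in> E2 - E1" "w \<in> E2 - E1" "u \<noteq> w"
        by (rule obtain_two_elements)
      then have "insert u ?I \<notin> D \<or> insert w ?I \<notin> D"
        using far_apart_extensions[OF assms(4) cI] by auto
      then have "insert u ?I \<in> all_but V k D \<or> insert w ?I \<in> all_but V k D"
        using cand uw by (simp add: all_but_def)
      then show ?thesis using uw by auto
    qed
  qed
  show ?thesis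
    unfolding k_matroid_def k_hypergraph_def using assms(1) ne exch
    by (auto simp: all_but_def)
qed

lemma indep_in_all_but:
  assumes "finite V" "1 \<le> k" "k < card V" "far_apart k D" "D \<subseteq> {E. card E = k}"
  shows "indep_in (all_but V k D) I \<longleftrightarrow> I \<subseteq> V \<and> card I \<le> k \<and> I \<notin> D"
proof
  assume "indep_in (all_but V k D) I"
  then obtain E where E: "E \<subseteq> V" "card E = k" "E \<notin> D" "I \<subseteq> E"
    by (auto simp: indep_in_def all_but_def)
  have "finite E" using E assms(1) finite_subset by blast
  then have "card I \<le> k" "card I = k \<Longrightarrow> I = E"
    using E card_mono card_subset_eq[of E I] by auto
  then show "I \<subseteq> V \<and> card I \<le> k \<and> I \<notin> D" using E assms(5) by auto
next
  assume I: "I \<subseteq> V \<and> card I \<le> k \<and> I \<notin> D"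
  show "indep_in (all_but V k D) I"
  proof (cases "card I = k")
    case True
    then show ?thesis using I by (auto simp: indep_in_def all_but_def)
  next
    case False
    then have "card I \<le> k - 1" "k - 1 \<le> card V" using I assms(3) by linarith+
    then obtain J where J: "I \<subseteq> J" "J \<subseteq> V" "card J = k - 1"
      using exists_subset_between[of I "k - 1" V] I assms(1) by blast
    then have "indep_in (all_but V k D) J"
      using paving_all_but[OF assms(1-4)] by (simp add: paving_def)
    then show ?thesis using J(1) unfolding indep_in_def by blast
  qed
qed

lemma indep_in_remove_two:
  assumes "finite V" "1 \<le> k" "k < card V" "card E0 = k" "card E = k" "Suc (card (E \<inter> E0)) < k"
    and "I \<noteq> E"
  shows "indep_in (all_but V k {E0, E}) I = indep_in (all_but V k {E0}) I"
proof -
  have "far_apart k {E0, E}" "far_apart k {E0}"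
    using assms(6) by (auto simp: far_apart_def Int_commute)
  then show ?thesis
    using assms indep_in_all_but[of V k "{E0, E}" I] indep_in_all_but[of V k "{E0}" I] by auto
qed

section \<open>Separability\<close>

lemma separable_remove_one:
  assumes "finite V" "1 \<le> k" "E0 \<subseteq> V" "card E0 = k"
  shows "separable_hypergraph V k (all_but V k {E0})"
proof -
  define x :: "'a \<Rightarrow> real" where "x v = (if v \<in> E0 then -1 else real k)" for v
  have "(\<Sum>v\<in>E. x v) \<ge> 0 \<longleftrightarrow> E \<noteq> E0" if E: "E \<subseteq> V" "card E = k" for E
  proof
    assume "(\<Sum>v\<in>E. x v) \<ge> 0"
    moreover have "(\<Sum>v\<in>E0. x v) < 0" using assms(2,4) by (simp add: x_def)
    ultimately show "E \<noteq> E0" by auto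
  next
    assume "E \<noteq> E0"
    have fin: "finite E" "finite E0" using E assms finite_subset by blast+
    then have "\<not> E \<subseteq> E0" using E \<open>E \<noteq> E0\<close> assms(4) card_subset_eq by metis
    then obtain w where w: "w \<in> E" "w \<notin> E0" by blast
    have "(\<Sum>v\<in>E - {w}. x v) \<ge> (\<Sum>v\<in>E - {w}. - 1)"
      by (intro sum_mono) (simp add: x_def)
    moreover have "(\<Sum>v\<in>E. x v) = real k + (\<Sum>v\<in>E - {w}. x v)"
      using fin w by (simp add: sum.remove x_def)
    moreover have "card (E - {w}) \<le> k" using E fin by (metis card_Diff1_le)
    ultimately show "(\<Sum>v\<in>E. x v) \<ge> 0" by simp
  qed
  then have "all_but V k {E0} = {E. E \<subseteq> V \<and> card E = k \<and> (\<Sum>v\<in>E. x v) \<ge> 0}"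
    by (auto simp: all_but_def)
  then show ?thesis unfolding separable_hypergraph_def by blast
qed

text \<open>
  Swapping \<open>a \<in> E - E0\<close> with \<open>b \<in> E0 - E\<close> preserves the sum of the two labels. Since each difference
  has at least two elements, neither swapped set is \<open>E\<close> or \<open>E0\<close>: two negative non-bases would have
  the same total label as two nonnegative bases.
\<close>

lemma not_separable_remove_two:
  assumes "finite V" "E0 \<subseteq> V" "card E0 = k" "E \<subseteq> V" "card E = k" "Suc (card (E \<inter> E0)) < k"
  shows "\<not> separable_hypergraph V k (all_but V k {E0, E})"
proof
  assume "separable_hypergraph V k (all_but V k {E0, E})"
  then obtain x :: "'a \<Rightarrow> real" where
    x: "all_but V k {E0, E} = {F. F \<subseteq> V \<and> card F = k \<and> (\<Sum>v\<in>F. x v) \<ge> 0}"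
    unfolding separable_hypergraph_def by blast
  have fin: "finite E" "finite E0" using assms finite_subset by blast+
  have cE: "card (E - E0) \<ge> 2" using assms(5,6) fin by (simp add: card_Diff_subset_Int)
  have cE0: "card (E0 - E) \<ge> 2"
    using assms(3,6) fin by (simp add: card_Diff_subset_Int Int_commute)
  obtain a a' where a: "a \<in> E - E0" "a' \<in> E - E0" "a \<noteq> a'"
    using cE by (rule obtain_two_elements)
  obtain b b' where b: "b \<in> E0 - E" "b' \<in> E0 - E" "b \<noteq> b'"
    using cE0 by (rule obtain_two_elements)
  define F where "F = insert b (E - {a})"
  define F0 where "F0 = insert a (E0 - {b})"
  have F: "F \<subseteq> V" "F0 \<subseteq> V" "card F = k" "card F0 = k"
    using a b assms fin card_Suc_Diff1[of E a] card_Suc_Diff1[of E0 b]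
    by (auto simp: F_def F0_def)
  have "F \<noteq> E" "F \<noteq> E0" "F0 \<noteq> E" "F0 \<noteq> E0"
    using a b by (auto simp: F_def F0_def)
  then have "F \<in> all_but V k {E0, E}" "F0 \<in> all_but V k {E0, E}"
    using F by (simp_all add: all_but_def)
  then have "(\<Sum>v\<in>F. x v) \<ge> 0" "(\<Sum>v\<in>F0. x v) \<ge> 0"
    unfolding x by simp_all
  moreover have "(\<Sum>v\<in>E. x v) < 0" "(\<Sum>v\<in>E0. x v) < 0"
  proof -
    have "E \<notin> all_but V k {E0, E}" "E0 \<notin> all_but V k {E0, E}" by (simp_all add: all_but_def)
    then show "(\<Sum>v\<in>E. x v) < 0" "(\<Sum>v\<in>E0. x v) < 0"
      using assms(2-5) unfolding x by simp_all
  qed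
  moreover have "(\<Sum>v\<in>F. x v) = x b + ((\<Sum>v\<in>E. x v) - x a)"
    using a b fin by (simp add: F_def sum_diff1)
  moreover have "(\<Sum>v\<in>F0. x v) = x a + ((\<Sum>v\<in>E0. x v) - x b)"
    using a b fin by (simp add: F0_def sum_diff1)
  ultimately show False by linarith
qed

section \<open>Counting the sets that must be queried\<close>

lemma all_far_sets_queried:
  assumes dec: "decides_separability_of_paving_matroids A"
    and V: "finite V" "1 \<le> k" "k < card V" and E0: "E0 \<subseteq> V" "card E0 = k"
    and run: "halts V (indep_in (all_but V k {E0})) (A V k) True q t"
  shows "card {E. E \<subseteq> V \<and> card E = k \<and> Suc (card (E \<inter> E0)) < k} \<le> q"
proof -
  obtain Q where Q: "finite Q" "card Q \<le> q"
    and branch: "\<And>orc'. \<forall>I\<in>Q. orc' I = indep_in (all_but V k {E0}) I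
      \<Longrightarrow> halts V orc' (A V k) True q t"
    using halts_queries[OF run] by blast
  have "E \<in> Q" if E: "E \<subseteq> V" "card E = k" "Suc (card (E \<inter> E0)) < k" for E
  proof (rule ccontr)
    assume "E \<notin> Q"
    let ?H = "all_but V k {E0, E}"
    have "far_apart k {E0, E}" using E(3) by (auto simp: far_apart_def Int_commute)
    then have "k_matroid V k ?H" "paving V k ?H"
      using k_matroid_all_but paving_all_but V by blast+
    moreover have "\<not> separable_hypergraph V k ?H"
      using not_separable_remove_two V(1) E0 E by blast
    ultimately obtain q' t' where "halts V (indep_in ?H) (A V k) False q' t'"
      using dec V unfolding decides_separability_of_paving_matroids_def by metis
    moreover have "halts V (indep_in ?H) (A V k) True q t"
      using branch indep_in_remove_two[OF V E0(2) E(2,3)] \<open>E \<notin> Q\<close> by metis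
    ultimately show False using halts_deterministic by blast
  qed
  then have "{E. E \<subseteq> V \<and> card E = k \<and> Suc (card (E \<inter> E0)) < k} \<subseteq> Q" by blast
  from card_mono[OF Q(1) this] Q(2) show ?thesis by (rule le_trans)
qed

text \<open>
  Pair every element of \<open>E0\<close> with a private substitute outside \<open>E0\<close>. Keeping an arbitrary
  \<open>S \<subseteq> E0\<close> that avoids two fixed elements and substituting all others gives different sets for
  different \<open>S\<close>, and each of them meets \<open>E0\<close> in at most \<open>k - 2\<close> elements.
\<close>

lemma many_far_sets:
  assumes "finite V" "E0 \<subseteq> V" "card E0 = k" "2 \<le> k" "2 * k \<le> card V"
  shows "2 ^ (k - 2) \<le> card {E. E \<subseteq> V \<and> card E = k \<and> Suc (card (E \<inter> E0)) < k}"
proof -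
  have fE0: "finite E0" using assms finite_subset by blast
  have "card (V - E0) \<ge> k" using assms fE0 by (simp add: card_Diff_subset)
  then obtain \<phi> where \<phi>: "\<phi> ` E0 \<subseteq> V - E0" "inj_on \<phi> E0"
    using card_le_inj[of E0 "V - E0"] assms(1,3) fE0 by auto
  obtain P where P: "P \<subseteq> E0" "card P = 2"
    using assms(3,4) by (metis obtain_subset_with_card_n)
  define g where "g S = S \<union> \<phi> ` (E0 - S)" for S
  have meet: "g S \<inter> E0 = S" if "S \<subseteq> E0" for S
    using that \<phi>(1) by (auto simp: g_def)
  have "inj_on g (Pow (E0 - P))"
    by (rule inj_on_inverseI[where g = "\<lambda>E. E \<inter> E0"]) (use meet in blast)
  then have "card (g ` Pow (E0 - P)) = 2 ^ card (E0 - P)"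
    using fE0 by (simp add: card_image card_Pow)
  also have "card (E0 - P) = k - 2"
    using P assms(3) fE0 finite_subset by (metis card_Diff_subset)
  finally have count: "card (g ` Pow (E0 - P)) = 2 ^ (k - 2)" .
  have far: "g ` Pow (E0 - P) \<subseteq> {E. E \<subseteq> V \<and> card E = k \<and> Suc (card (E \<inter> E0)) < k}"
  proof clarify
    fix S assume S: "S \<subseteq> E0 - P"
    have fS: "finite S" "S \<subseteq> E0" using S fE0 finite_subset by blast+
    have "card (g S) = card S + card (\<phi> ` (E0 - S))"
      unfolding g_def using fS fE0 \<phi>(1) by (intro card_Un_disjoint) auto
    also have "card (\<phi> ` (E0 - S)) = card (E0 - S)"
      using \<phi>(2) by (meson Diff_subset card_image inj_on_subset)
    also have "card S + card (E0 - S) = k"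
      using fS fE0 assms(3) by (metis card_Diff_subset card_mono le_add_diff_inverse)
    finally have "card (g S) = k" .
    moreover have "card S \<le> k - 2"
      using S fE0 \<open>card (E0 - P) = k - 2\<close> by (metis card_mono finite_Diff)
    ultimately show "g S \<subseteq> V \<and> card (g S) = k \<and> Suc (card (g S \<inter> E0)) < k"
      using meet[OF fS(2)] fS(2) \<phi>(1) assms(2,4) by (auto simp: g_def)
  qed
  show ?thesis
    unfolding count[symmetric] using assms(1) by (intro card_mono[OF _ far]) simp
qed

theorem mainTheorem9:
  "\<exists>c::real. c > 1 \<and> (\<exists>N::nat.
     \<forall>A :: nat set \<Rightarrow> nat \<Rightarrow> nat program.
       decides_separability_of_paving_matroids A \<longrightarrow>
       (\<forall>V :: nat set. finite V \<and> N \<le> card V \<longrightarrow>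
         (\<exists>k H b q t. 1 \<le> k \<and> k < card V \<and> k_matroid V k H \<and> paving V k H \<and>
            halts V (indep_in H) (A V k) b q t \<and>
            c ^ card V \<le> real q \<and> c ^ card V \<le> real t)))"
proof -
  have main: "\<exists>k H b q t. 1 \<le> k \<and> k < card V \<and> k_matroid V k H \<and> paving V k H \<and>
            halts V (indep_in H) (A V k) b q t \<and>
            (11/10) ^ card V \<le> real q \<and> (11/10) ^ card V \<le> real t"
    if dec: "decides_separability_of_paving_matroids A" and V: "finite V" "10 \<le> card V"
    for A :: "nat set \<Rightarrow> nat \<Rightarrow> nat program" and V
  proof -
    define k where "k = card V div 2"
    have k: "1 \<le> k" "2 \<le> k" "k < card V" "2 * k \<le> card V" using V(2) by (auto simp: k_def)
    obtain E0 where E0: "E0 \<subseteq> V" "card E0 = k"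
      using k(3) by (meson obtain_subset_with_card_n less_imp_le)
    let ?H = "all_but V k {E0}"
    have "far_apart k {E0}" by (simp add: far_apart_def)
    then have H: "k_matroid V k ?H" "paving V k ?H"
      using k_matroid_all_but paving_all_but V(1) k(1,3) by blast+
    moreover have "separable_hypergraph V k ?H"
      using separable_remove_one[OF V(1) k(1) E0] .
    ultimately obtain q t where run: "halts V (indep_in ?H) (A V k) True q t"
      using dec k unfolding decides_separability_of_paving_matroids_def by metis
    have "2 ^ (k - 2) \<le> q"
      using all_far_sets_queried[OF dec V(1) k(1,3) E0 run] many_far_sets[OF V(1) E0 k(2,4)]
      by linarith
    then have "2 ^ (k - 2) \<le> real q" by (metis of_nat_le_iff of_nat_numeral of_nat_power)
    \<comment> \<open>The constant \<open>11/10\<close> has fourth power below \<open>2\<close>, and \<open>n \<le> 4 (k - 2)\<close> as soon as \<open>n \<ge> 10\<close>.\<close>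
    moreover have "(11/10) ^ card V \<le> (2::real) ^ (k - 2)"
    proof -
      have "card V \<le> 4 * (k - 2)" using V(2) unfolding k_def by presburger
      then have "(11/10::real) ^ card V \<le> (11/10) ^ (4 * (k - 2))"
        by (intro power_increasing) auto
      also have "\<dots> = ((11/10) ^ 4) ^ (k - 2)" by (rule power_mult)
      also have "\<dots> \<le> 2 ^ (k - 2)" by (intro power_mono) (auto simp: power4_eq_xxxx)
      finally show ?thesis .
    qed
    ultimately have "(11/10) ^ card V \<le> real q" by linarith
    moreover have "real q \<le> real t" using halts_queries_le_steps[OF run] by simp
    ultimately have "(11/10) ^ card V \<le> real t" by linarith
    then show ?thesis using k(1,3) H run \<open>(11/10) ^ card V \<le> real q\<close> by blast
  qed
  show ?thesis
  proof (rule exI[of _ "11/10"], rule conjI)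
    show "(1::real) < 11/10" by simp
  qed (rule exI[of _ 10], use main in blast)
qed

end
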